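(* Let $S$ be a topological semilattice, $K$ a nonempty compact convex subset of $S$, and $L$ a chain (linearly ordered set). Let $f:K\to L$ be a convex, upper-semicontinuous map. Then $\operatorname{argmax} f$ (the set of points of $K$ at which $f$ attains its maximum over $K$) is a face of $K$, and $f$ attains its maximum on $\operatorname{ex}K$ (i.e. there is $e\in\operatorname{ex}K$ with $f(e)=\max_{x\in K}f(x)$).
   Context: A semilattice is a poset $S$ in which every nonempty finite subset $F$ has a supremum $\bigoplus F$; write $x\oplus y=\bigoplus\{x,y\}$. A topological semilattice is a semilattice with a Hausdorff topology for which $\oplus:S\times S\to S$ is jointly continuous. A subset of $S$ is convex if it is a subsemilattice (closed under $\oplus$); $\operatorname{co}(A)$ is the subsemilattice generated by $A$ (with $\operatorname{co}(\emptyset)=\emptyset$). A point $x\in K$ is an extreme point of $K$ if $x\notin\operatorname{co}(K\setminus\{x\})$; $\operatorname{ex}K$ is the set of extreme points of $K$. A map $f:K\to L$ into a chain (seen as a semilattice, $\oplus=\max$) is convex if $f(x\oplus y)\leqslant f(x)\oplus f(y)$ for all $x,y\in K$. It is upper-semicontinuous if $\{x\in K: f(x)<t\}$ is open in $K$ for all $t\in L$. A subset $E$ of $K$ is extreme in $K$ if, for all $x,y\in K$, $x\oplus y\in E$ implies $x\in E$ or $y\in E$. A face of $K$ is a nonempty compact subset of $K$ that is extreme in $K$. *)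

theory Defs
  imports "HOL-Analysis.Abstract_Topology"
begin

text \<open>
  The join \<open>x \<oplus> y\<close> of a semilattice is rendered as \<open>sup x y\<close>; class \<open>semilattice_sup\<close> says that
  it is the supremum of \<open>{x, y}\<close>. Joint continuity is formulated as for the library class
  \<open>topological_monoid_add\<close>; see \<open>continuous_on_sup_Pair\<close> below for the usual form.
\<close>

class topological_semilattice = semilattice_sup + t2_space +
  assumes tendsto_sup_Pair: "LIM x (nhds a \<times>\<^sub>F nhds b). sup (fst x) (snd x) :> nhds (sup a b)"

lemma continuous_on_sup_Pair:
  "continuous_on UNIV (\<lambda>(x, y). sup x y :: 'a::topological_semilattice)"
proof (unfold continuous_on_def, intro ballI)
  fix p :: "'a \<times> 'a"
  obtain a b where p: "p = (a, b)" by (cases p)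
  show "((\<lambda>(x, y). sup x y) \<longlongrightarrow> (case p of (x, y) \<Rightarrow> sup x y)) (at p)"
    using tendsto_sup_Pair[of a b] unfolding p
    by (auto simp: nhds_prod[symmetric] case_prod_beta tendsto_def eventually_at_filter
             elim!: eventually_mono)
qed

text \<open>Convex sets in the semilattice sense; the empty set is allowed.\<close>

definition semilattice_convex :: "'a::semilattice_sup set \<Rightarrow> bool" where
  "semilattice_convex A \<longleftrightarrow> (\<forall>x\<in>A. \<forall>y\<in>A. sup x y \<in> A)"

definition semilattice_co :: "'a::semilattice_sup set \<Rightarrow> 'a set" where
  "semilattice_co A = semilattice_convex hull A"

definition extreme_points :: "'a::semilattice_sup set \<Rightarrow> 'a set" where
  "extreme_points K = {x \<in> K. x \<notin> semilattice_co (K - {x})}"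

text \<open>
  A map \<open>K \<rightarrow> L\<close> is represented by a function on the whole type of which only the values on
  \<open>K\<close> matter.
\<close>

definition semilattice_convex_map_on ::
    "'a::semilattice_sup set \<Rightarrow> ('a \<Rightarrow> 'b::linorder) \<Rightarrow> bool" where
  "semilattice_convex_map_on K f \<longleftrightarrow> (\<forall>x\<in>K. \<forall>y\<in>K. f (sup x y) \<le> max (f x) (f y))"

definition upper_semicontinuous_map_on ::
    "'a::topological_space set \<Rightarrow> ('a \<Rightarrow> 'b::linorder) \<Rightarrow> bool" where
  "upper_semicontinuous_map_on K f \<longleftrightarrow> (\<forall>t. openin (top_of_set K) {x \<in> K. f x < t})"

definition semilattice_extreme_in :: "'a::semilattice_sup set \<Rightarrow> 'a set \<Rightarrow> bool" where
  "semilattice_extreme_in E K \<longleftrightarrow>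
     E \<subseteq> K \<and> (\<forall>x\<in>K. \<forall>y\<in>K. sup x y \<in> E \<longrightarrow> x \<in> E \<or> y \<in> E)"

definition semilattice_face_in :: "'a::topological_semilattice set \<Rightarrow> 'a set \<Rightarrow> bool" where
  "semilattice_face_in F K \<longleftrightarrow> F \<noteq> {} \<and> compact F \<and> semilattice_extreme_in F K"

definition argmax_on :: "'a set \<Rightarrow> ('a \<Rightarrow> 'b::linorder) \<Rightarrow> 'a set" where
  "argmax_on K f = {x \<in> K. \<forall>y\<in>K. f y \<le> f x}"

end

theory Submission
  imports Defs
begin

text \<open>
  Convexity of \<open>f\<close> says that \<open>f (sup x y)\<close> never exceeds both \<open>f x\<close> and \<open>f y\<close>. If \<open>sup x y\<close> is a
  maximiser, one of \<open>x\<close>, \<open>y\<close> therefore is one too: the set of maximisers is extreme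
  (\<open>extreme_in_argmax_on\<close>). It is nonempty and compact because it is the intersection of the
  superlevel sets \<open>{x \<in> K. f y \<le> f x}\<close>, which are closed in \<open>K\<close> by upper semicontinuity and
  have the finite intersection property since the values of \<open>f\<close> lie in a chain.

  Every face \<open>F\<close> contains an extreme point, and the semilattice order alone finds it: a minimal
  element of \<open>F\<close>. Down-sets of points are closed, so compactness and Zorn's lemma provide a minimal
  element \<open>e\<close> (\<open>compact_has_minimal\<close>). If \<open>e = sup x y\<close> with \<open>x\<close> and \<open>y\<close> in \<open>K\<close>, then one of
  them lies in \<open>F\<close>; it is below \<open>e\<close> and hence equal to \<open>e\<close>. So \<open>K - {e}\<close> is a subsemilattice,
  which is to say that \<open>e\<close> is an extreme point of \<open>K\<close> (\<open>face_has_extreme_point\<close>).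
\<close>

lemma closed_atMost_semilattice: "closed {..c :: 'a::topological_semilattice}"
proof -
  have "continuous_on UNIV (\<lambda>x::'a. case (x, c) of (x, y) \<Rightarrow> sup x y)"
    by (rule continuous_on_compose2[OF continuous_on_sup_Pair]) (auto intro!: continuous_intros)
  then have "closed {x. sup x c = c}"
    by (intro closed_Collect_eq) auto
  also have "{x. sup x c = c} = {..c}"
    by (simp add: atMost_def le_iff_sup)
  finally show ?thesis .
qed

text \<open>
  The traces on \<open>F\<close> of the down-sets of a chain are nested nonempty closed sets, so they have a
  common point. It bounds the chain from below, as Zorn's lemma for the reverse order requires.
\<close>

lemma compact_has_minimal:
  fixes F :: "'a::topological_semilattice set"
  assumes "compact F" and "F \<noteq> {}"
  obtains e where "e \<in> F" and "\<And>x. x \<in> F \<Longrightarrow> x \<le> e \<Longrightarrow> x = e"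
proof -
  let ?r = "relation_of (\<ge>) F"
  have "\<exists>m\<in>F. \<forall>x\<in>F. m \<ge> x \<longrightarrow> x = m"
  proof (rule predicate_Zorn)
    show "partial_order_on F ?r"
      by (rule partial_order_on_relation_ofI) auto
  next
    fix C assume C: "C \<in> Chains ?r"
    have "C \<subseteq> F" and total: "\<And>a b. a \<in> C \<Longrightarrow> b \<in> C \<Longrightarrow> a \<le> b \<or> b \<le> a"
      using C by (auto simp: Chains_def relation_of_def)
    have lower_bound: "\<exists>u\<in>F. \<forall>a\<in>D. u \<le> a" if "finite D" and "D \<subseteq> C" for D
    proof (cases "D = {}")
      case True
      then show ?thesis using \<open>F \<noteq> {}\<close> by auto
    next
      case False
      from \<open>finite D\<close> False \<open>D \<subseteq> C\<close> have "\<exists>u\<in>D. \<forall>a\<in>D. u \<le> a"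
      proof (induction rule: finite_ne_induct)
        case (insert d D)
        then obtain u where "u \<in> D" "\<forall>a\<in>D. u \<le> a" by auto
        from total[of u d] insert.prems \<open>u \<in> D\<close> have "u \<le> d \<or> d \<le> u" by auto
        then show ?case
        proof
          assume "u \<le> d"
          then show ?thesis using \<open>u \<in> D\<close> \<open>\<forall>a\<in>D. u \<le> a\<close> by blast
        next
          assume "d \<le> u"
          then have "\<forall>a\<in>D. d \<le> a" using \<open>\<forall>a\<in>D. u \<le> a\<close> order_trans by blast
          then show ?thesis by blast
        qed
      qed simp
      then show ?thesis using \<open>C \<subseteq> F\<close> \<open>D \<subseteq> C\<close> by blast
    qed
    have "F \<inter> (\<Inter>c\<in>D. {..c}) \<noteq> {}" if "finite D" and "D \<subseteq> C" for D
    proof -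
      obtain u where "u \<in> F" "\<forall>a\<in>D. u \<le> a"
        using lower_bound[of D] \<open>finite D\<close> \<open>D \<subseteq> C\<close> by blast
      then have "u \<in> F \<inter> (\<Inter>c\<in>D. {..c})" by simp
      then show ?thesis by blast
    qed
    then have "F \<inter> (\<Inter>c\<in>C. {..c}) \<noteq> {}"
      by (rule compact_imp_fip_image[OF \<open>compact F\<close> closed_atMost_semilattice])
    then show "\<exists>u\<in>F. \<forall>a\<in>C. a \<ge> u" by auto
  qed
  then show thesis using that by blast
qed

lemma extreme_pointI:
  assumes "e \<in> K" and "semilattice_convex (K - {e})"
  shows "e \<in> extreme_points K"
  using assms by (simp add: extreme_points_def semilattice_co_def hull_same)

lemma face_has_extreme_point:
  assumes "semilattice_face_in F K" and "semilattice_convex K"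
  obtains e where "e \<in> F" and "e \<in> extreme_points K"
proof -
  have "F \<subseteq> K"
    and ext: "\<And>x y. x \<in> K \<Longrightarrow> y \<in> K \<Longrightarrow> sup x y \<in> F \<Longrightarrow> x \<in> F \<or> y \<in> F"
    using assms(1) by (auto simp: semilattice_face_in_def semilattice_extreme_in_def)
  obtain e where "e \<in> F" and min: "\<And>x. x \<in> F \<Longrightarrow> x \<le> e \<Longrightarrow> x = e"
    using compact_has_minimal[of F] assms(1) by (auto simp: semilattice_face_in_def)
  have "x = e \<or> y = e" if "x \<in> K" "y \<in> K" "sup x y = e" for x y
    using ext[of x y] min[of x] min[of y] that \<open>e \<in> F\<close> by auto
  then have "semilattice_convex (K - {e})"
    using assms(2) by (auto simp: semilattice_convex_def)
  then have "e \<in> extreme_points K"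
    using \<open>e \<in> F\<close> \<open>F \<subseteq> K\<close> by (intro extreme_pointI) auto
  with \<open>e \<in> F\<close> show thesis by (rule that)
qed

lemma compact_superlevel:
  fixes K :: "'a::topological_space set" and f :: "'a \<Rightarrow> 'b::linorder"
  assumes "compact K" and "upper_semicontinuous_map_on K f"
  shows "compact {x \<in> K. t \<le> f x}"
proof -
  obtain U where "open U" and U: "{x \<in> K. f x < t} = K \<inter> U"
    using assms(2) by (auto simp: upper_semicontinuous_map_on_def openin_open)
  have "{x \<in> K. t \<le> f x} = K - {x \<in> K. f x < t}"
    by auto
  also have "\<dots> = K - U"
    unfolding U by blast
  finally have "{x \<in> K. t \<le> f x} = K - U" .
  then show ?thesis
    using compact_diff[OF assms(1) \<open>open U\<close>] by simp
qed

text \<open>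
  This is the Weierstrass theorem for values in an arbitrary chain, where suprema may be missing;
  so the superlevel sets are indexed by the points of \<open>K\<close>, that is, by attained values only.
\<close>

lemma argmax_on_nonempty_compact:
  fixes K :: "'a::t2_space set" and f :: "'a \<Rightarrow> 'b::linorder"
  assumes "K \<noteq> {}" and "compact K" and "upper_semicontinuous_map_on K f"
  shows "argmax_on K f \<noteq> {}" and "compact (argmax_on K f)"
proof -
  let ?A = "\<lambda>y. {x \<in> K. f y \<le> f x}"
  have closed: "closed (?A y)" for y
    using compact_superlevel[OF assms(2,3)] by (rule compact_imp_closed)
  have argmax: "argmax_on K f = K \<inter> (\<Inter>y\<in>K. ?A y)"
    by (auto simp: argmax_on_def)
  have "K \<inter> (\<Inter>y\<in>D. ?A y) \<noteq> {}" if "finite D" and "D \<subseteq> K" for D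
  proof (cases "D = {}")
    case False
    then have "Max (f ` D) \<in> f ` D" using \<open>finite D\<close> by simp
    then obtain m where "m \<in> D" "f m = Max (f ` D)" by auto
    then have "m \<in> K \<inter> (\<Inter>y\<in>D. ?A y)" using that by auto
    then show ?thesis by blast
  qed (use \<open>K \<noteq> {}\<close> in simp)
  then show "argmax_on K f \<noteq> {}"
    unfolding argmax by (rule compact_imp_fip_image[OF \<open>compact K\<close> closed])
  show "compact (argmax_on K f)"
    unfolding argmax using closed by (intro compact_Int_closed[OF \<open>compact K\<close>]) auto
qed

lemma extreme_in_argmax_on:
  assumes "semilattice_convex_map_on K f"
  shows "semilattice_extreme_in (argmax_on K f) K"
  unfolding semilattice_extreme_in_def
proof (intro conjI ballI impI)
  show "argmax_on K f \<subseteq> K" by (auto simp: argmax_on_def)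
next
  fix x y assume "x \<in> K" "y \<in> K" and max: "sup x y \<in> argmax_on K f"
  then have "f (sup x y) \<le> f x \<or> f (sup x y) \<le> f y"
    using assms by (simp add: semilattice_convex_map_on_def le_max_iff_disj)
  then show "x \<in> argmax_on K f \<or> y \<in> argmax_on K f"
    using max \<open>x \<in> K\<close> \<open>y \<in> K\<close> unfolding argmax_on_def by (blast intro: order_trans)
qed

theorem proposition4p6:
  fixes K :: "'a::topological_semilattice set"
    and f :: "'a \<Rightarrow> 'b::linorder"
  assumes "K \<noteq> {}"
    and "compact K"
    and "semilattice_convex K"
    and "semilattice_convex_map_on K f"
    and "upper_semicontinuous_map_on K f"
  shows "semilattice_face_in (argmax_on K f) K \<and>
    (\<exists>e\<in>extreme_points K. \<forall>x\<in>K. f x \<le> f e)"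
proof
  show face: "semilattice_face_in (argmax_on K f) K"
    unfolding semilattice_face_in_def
    using argmax_on_nonempty_compact[OF assms(1,2,5)] extreme_in_argmax_on[OF assms(4)] by blast
  obtain e where "e \<in> argmax_on K f" "e \<in> extreme_points K"
    using face_has_extreme_point[OF face assms(3)] .
  then show "\<exists>e\<in>extreme_points K. \<forall>x\<in>K. f x \<le> f e"
    by (auto simp: argmax_on_def)
qed

end
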